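(* Let $E=(d_1,\ldots,d_{m-1})$ be a valid ordered tuple, $d=d_1+\cdots+d_{m-1}$, and let $a_0<a_1<\cdots$ be the terms of $S_E$. For some positive integer $z$, let $R=\{a_0,\ldots,a_z\}$, $\max(R)=a_z$, and $c=a_{z+1}$. Suppose: (i) $c=1+d\max(R)-\sum_{k=2}^{m-1}d_k(m-k-1)$; (ii) for every integer $0\le r_1\le c-1$ and every integer $0\le j\le d-2$, there exist a subset $H_j\subseteq\{2,\ldots,m-1\}$ and $r_2,\ldots,r_m\in R$ such that $\sum_{k\in H_j}d_k=j$, $\sum_{k=1}^{m-1}d_kr_k=dr_m$, the values $r_k$ ($k\in H_j\cup\{m\}$) are pairwise distinct, and the values $r_k$ ($k\in\{2,\ldots,m-1\}\setminus H_j$) are pairwise distinct. Then every term of $S_E$ can be expressed in the form $c\sum_{i\ge0}t_i(d+1)^i+r$ with $t_i\in\{0,1\}$ for all $i$ (finitely many nonzero) and $r\in R$.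
   Context: An ordered tuple $E=(d_1,\ldots,d_{m-1})$ of positive integers is written in nondecreasing order; $d=d_1+\cdots+d_{m-1}$; $E$ is valid if $d_1=1$ and $d_l\le d_1+\cdots+d_{l-1}$ for every $2\le l\le m-1$. The sequence $S_E$ is defined greedily: $a_0=0$, and having chosen $a_0,\ldots,a_k$, $a_{k+1}$ is the least integer greater than $a_k$ such that there are no distinct $x_1,\ldots,x_m\in\{a_0,\ldots,a_{k+1}\}$ with $d_1x_1+\cdots+d_{m-1}x_{m-1}=dx_m$. *)

theory Defs
  imports Main
begin

(* A tuple (d_1, ..., d_{m-1}) is a list E with m = length E + 1; entries are
   numbered from 1, so that d_k is E ! (k - 1), and d is sum_list E. *)

definition coeff :: "nat list \<Rightarrow> nat \<Rightarrow> nat" where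
  "coeff E k = E ! (k - 1)"

definition valid_tuple :: "nat list \<Rightarrow> bool" where
  "valid_tuple E \<longleftrightarrow>
     E \<noteq> [] \<and> (\<forall>e\<in>set E. 0 < e) \<and> sorted E \<and> coeff E 1 = 1 \<and>
     (\<forall>l\<in>{2..length E}. coeff E l \<le> (\<Sum>i=1..l-1. coeff E i))"

definition has_distinct_solution :: "nat list \<Rightarrow> nat set \<Rightarrow> bool" where
  "has_distinct_solution E X \<longleftrightarrow>
     (\<exists>x :: nat \<Rightarrow> nat. x ` {1..length E + 1} \<subseteq> X \<and> inj_on x {1..length E + 1} \<and>
        (\<Sum>k=1..length E. coeff E k * x k) = sum_list E * x (length E + 1))"

fun greedy_seq :: "nat list \<Rightarrow> nat \<Rightarrow> nat" where
  "greedy_seq E 0 = 0"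
| "greedy_seq E (Suc k) =
     (LEAST n. greedy_seq E k < n \<and>
        \<not> has_distinct_solution E (insert n (greedy_seq E ` {..k})))"

lemma sum_coeff: "(\<Sum>k=1..length E. coeff E k) = sum_list E"
proof -
  have "(\<Sum>k=1..length E. coeff E k) = (\<Sum>k=0..<length E. E ! k)"
    by (rule sum.reindex_bij_witness[where i = Suc and j = "\<lambda>k. k - 1"])
       (auto simp: coeff_def)
  then show ?thesis
    by (simp add: sum_list_sum_nth)
qed

lemma coeff_pos: "valid_tuple E \<Longrightarrow> k \<in> {1..length E} \<Longrightarrow> 0 < coeff E k"
  by (auto simp: valid_tuple_def coeff_def)

(* For valid tuples the set in the LEAST above is never empty. *)

lemma has_distinct_solution_insert_large:
  assumes E: "valid_tuple E" and X: "\<forall>y\<in>X. sum_list E * y < n \<and> y < n"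
    and sol: "has_distinct_solution E (insert n X)"
  shows "has_distinct_solution E X"
proof -
  let ?m = "length E + 1"
  obtain x :: "nat \<Rightarrow> nat" where x: "x ` {1..?m} \<subseteq> insert n X" "inj_on x {1..?m}"
    and eq: "(\<Sum>k=1..length E. coeff E k * x k) = sum_list E * x ?m"
    using sol unfolding has_distinct_solution_def by blast
  have ne: "1 \<le> length E"
    using E by (cases E) (auto simp: valid_tuple_def)
  have "n \<notin> x ` {1..?m}"
  proof
    assume "n \<in> x ` {1..?m}"
    then obtain i where i: "i \<in> {1..?m}" "x i = n" by auto
    have other: "x k \<in> X" if "k \<in> {1..?m}" "k \<noteq> i" for k
      using that i x inj_onD[OF x(2), of k i] by (metis image_subset_iff insertE)
    show False
    proof (cases "i = ?m")
      case True
      have "(\<Sum>k=1..length E. coeff E k * x k) < (\<Sum>k=1..length E. coeff E k * n)"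
      proof (rule sum_strict_mono)
        fix k assume k: "k \<in> {1..length E}"
        then have "x k \<in> X" using other True by auto
        then show "coeff E k * x k < coeff E k * n"
          using X coeff_pos[OF E k] by auto
      qed (use ne in auto)
      also have "\<dots> = sum_list E * n"
        by (simp only: sum_coeff flip: sum_distrib_right)
      finally show False using eq True i by simp
    next
      case False
      then have iE: "i \<in> {1..length E}" using i by auto
      have "n \<le> coeff E i * x i"
        using coeff_pos[OF E iE] i by simp
      also have "\<dots> \<le> (\<Sum>k=1..length E. coeff E k * x k)"
        using iE by (intro member_le_sum) auto
      finally show False
        using eq X other[of ?m] False by (auto simp: not_le)
    qed
  qed
  then show ?thesis
    using x eq unfolding has_distinct_solution_def by blast
qed

lemma greedy_seq_Suc:
  assumes E: "valid_tuple E"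
  shows "greedy_seq E k < greedy_seq E (Suc k) \<and>
    \<not> has_distinct_solution E (greedy_seq E ` {..Suc k})"
proof -
  have step: "greedy_seq E k < greedy_seq E (Suc k) \<and>
      \<not> has_distinct_solution E (insert (greedy_seq E (Suc k)) (greedy_seq E ` {..k}))"
    if no: "\<not> has_distinct_solution E (greedy_seq E ` {..k})" for k
  proof -
    let ?X = "greedy_seq E ` {..k}"
    let ?n = "Suc ((sum_list E + 1) * Max ?X)"
    have le: "y \<le> Max ?X" if "y \<in> ?X" for y
      using that by simp
    have X: "\<forall>y\<in>?X. sum_list E * y < ?n \<and> y < ?n"
    proof
      fix y assume y: "y \<in> ?X"
      have "sum_list E * y \<le> (sum_list E + 1) * Max ?X" "1 * y \<le> (sum_list E + 1) * Max ?X"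
        using le[OF y] by (intro mult_le_mono; simp)+
      then show "sum_list E * y < ?n \<and> y < ?n" by (simp only: less_Suc_eq_le mult_1)
    qed
    have "greedy_seq E k < ?n \<and> \<not> has_distinct_solution E (insert ?n ?X)"
      using has_distinct_solution_insert_large[OF E X] no X by blast
    then show ?thesis
      unfolding greedy_seq.simps by (rule LeastI)
  qed
  have no: "\<not> has_distinct_solution E (greedy_seq E ` {..k})" for k
  proof (induction k)
    case 0
    show ?case
    proof
      assume "has_distinct_solution E (greedy_seq E ` {..0})"
      then obtain x :: "nat \<Rightarrow> nat" where x: "x ` {1..length E + 1} \<subseteq> {0}"
        and inj: "inj_on x {1..length E + 1}"
        unfolding has_distinct_solution_def by auto
      have "E \<noteq> []" using E by (simp add: valid_tuple_def)
      then have "{1, length E + 1} \<subseteq> {1..length E + 1}" "1 \<noteq> length E + 1" by auto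
      then show False using x inj unfolding inj_on_def by (metis image_subset_iff insert_subset singletonD)
    qed
  next
    case (Suc k)
    then show ?case using step[of k] by (simp add: atMost_Suc)
  qed
  show ?thesis using step[OF no, of k] no[of "Suc k"] by blast
qed

end

theory Submission
  imports Defs
begin

text \<open>
  Let \<open>T\<close> be the set of numbers whose base \<open>d + 1\<close> digits are all 0 or 1, and
  \<open>A = {c t + r | t \<in> T, r \<in> R}\<close>. The terms of the sequence are exactly the elements of \<open>A\<close>,
  because \<open>A\<close> satisfies the greedy recursion.

  No solution in \<open>A\<close>: write \<open>x\<^sub>k = c t\<^sub>k + r\<^sub>k\<close>. Hypothesis (i) gives \<open>2 c > d max R\<close>, so
  \<open>\<Sum> d\<^sub>k t\<^sub>k\<close> and \<open>d t\<^sub>m\<close> differ by at most 1. In base \<open>d + 1\<close> the sum \<open>\<Sum> d\<^sub>k t\<^sub>k\<close> has no carries.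
  If the two are equal, all \<open>t\<^sub>k\<close> agree and the \<open>r\<^sub>k\<close> solve the equation in \<open>R\<close>. Otherwise all \<open>t\<^sub>k\<close>
  with \<open>k < m\<close> but one of weight 1 agree; the corresponding \<open>r\<^sub>k\<close> are then distinct, and the
  rearrangement inequality contradicts the value of \<open>c\<close> in (i).

  Every \<open>n \<notin> A\<close> is excluded: write \<open>n = c u + r\<^sub>1\<close> with \<open>r\<^sub>1 < c\<close>. If \<open>u \<in> T\<close>, then \<open>r\<^sub>1 \<notin> R\<close>, and
  the solution excluding \<open>r\<^sub>1\<close> is translated by \<open>c u\<close>. If \<open>u \<notin> T\<close>, some digit \<open>e\<close> of \<open>u\<close> is at
  least 2, and (ii) with \<open>j = d - e\<close> yields a solution with \<open>x\<^sub>1 = n\<close>.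
\<close>

section \<open>Numbers whose digits are all 0 or 1\<close>

inductive_set binary_digit_numbers :: "nat \<Rightarrow> nat set" for b :: nat where
  zero: "0 \<in> binary_digit_numbers b"
| step: "t \<in> binary_digit_numbers b \<Longrightarrow> e \<le> 1 \<Longrightarrow> e + b * t \<in> binary_digit_numbers b"

lemma binary_digit_numbers_split:
  assumes "t \<in> binary_digit_numbers b"
  shows "\<exists>e s. t = e + b * s \<and> e \<le> 1 \<and> s \<in> binary_digit_numbers b"
  using assms
proof cases
  case zero
  then show ?thesis
    by (intro exI[of _ 0]) (auto intro: binary_digit_numbers.zero)
qed auto

lemma binary_digit_numbers_split_fun:
  assumes "\<And>k. k \<in> K \<Longrightarrow> t k \<in> binary_digit_numbers b"
  shows "\<exists>e s. \<forall>k\<in>K. t k = e k + b * s k \<and> e k \<le> 1 \<and> s k \<in> binary_digit_numbers b"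
proof -
  have "\<forall>k\<in>K. \<exists>e s. t k = e + b * s \<and> e \<le> 1 \<and> s \<in> binary_digit_numbers b"
    using binary_digit_numbers_split[OF assms] by blast
  then show ?thesis
    unfolding bchoice_iff by blast
qed

text \<open>\<open>F\<close> is the set of positions with digit 1: a new lowest digit shifts all
  positions by \<open>Suc\<close> and, if it is 1, adds position 0.\<close>

lemma binary_digit_numbers_sum_powers:
  assumes "t \<in> binary_digit_numbers b"
  shows "\<exists>F. finite F \<and> t = (\<Sum>i\<in>F. b ^ i)"
  using assms
proof induction
  case zero
  show ?case by (intro exI[of _ "{}"]) simp
next
  case (step t e)
  then obtain F where F: "finite F" "t = (\<Sum>i\<in>F. b ^ i)" by blast
  have shift: "(\<Sum>i\<in>Suc ` F. b ^ i) = b * t"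
    using F by (simp add: sum.reindex sum_distrib_left)
  show ?case
  proof (cases "e = 0")
    case True
    then show ?thesis using shift F by (intro exI[of _ "Suc ` F"]) simp
  next
    case False
    then have "e = 1" using step by simp
    then show ?thesis using shift F by (intro exI[of _ "insert 0 (Suc ` F)"]) simp
  qed
qed

section \<open>Weighted sums of such numbers in base \<open>d + 1\<close>\<close>

lemma sum_weighted_digits:
  fixes w :: "'a \<Rightarrow> nat"
  assumes "\<And>k. k \<in> I \<Longrightarrow> t k = e k + b * s k"
  shows "(\<Sum>k\<in>I. w k * t k) = (\<Sum>k\<in>I. w k * e k) + b * (\<Sum>k\<in>I. w k * s k)"
proof -
  have "(\<Sum>k\<in>I. w k * t k) = (\<Sum>k\<in>I. w k * e k + b * (w k * s k))"
    using assms by (intro sum.cong) (auto simp: algebra_simps)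
  then show ?thesis by (simp add: sum.distrib sum_distrib_left)
qed

lemma sum_weighted_bits_le:
  fixes w :: "'a \<Rightarrow> nat"
  assumes "\<And>k. k \<in> I \<Longrightarrow> e k \<le> 1"
  shows "(\<Sum>k\<in>I. w k * e k) \<le> sum w I"
proof (rule sum_mono)
  fix k assume "k \<in> I"
  then show "w k * e k \<le> w k" using mult_le_mono2[OF assms, of k "w k"] by simp
qed

text \<open>Flipping the bits trades the values \<open>sum w I\<close> and
  \<open>sum w I - 1\<close> of a weighted bit sum for 0 and 1, the values treated in the next two
  lemmas.\<close>

lemma sum_weighted_bits_complement:
  fixes w :: "'a \<Rightarrow> nat"
  assumes "\<And>k. k \<in> I \<Longrightarrow> e k \<le> 1"
  shows "(\<Sum>k\<in>I. w k * e k) + (\<Sum>k\<in>I. w k * (1 - e k)) = sum w I"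
proof -
  have "w k * e k + w k * (1 - e k) = w k" if "k \<in> I" for k
    using assms[OF that] by (cases "e k") auto
  then show ?thesis by (simp add: sum.distrib[symmetric])
qed

lemma weighted_sum_eq_zero:
  fixes w :: "'a \<Rightarrow> nat"
  assumes "finite I" "\<forall>k\<in>I. 0 < w k" "(\<Sum>k\<in>I. w k * e k) = 0"
  shows "\<forall>k\<in>I. e k = 0"
  using assms by fastforce

lemma sum_weighted_bits_eq_one:
  fixes w :: "'a \<Rightarrow> nat"
  assumes I: "finite I" and e: "\<And>k. k \<in> I \<Longrightarrow> e k \<le> 1" and pos: "\<forall>k\<in>I. 0 < w k"
    and one: "(\<Sum>k\<in>I. w k * e k) = 1"
  shows "\<exists>k0\<in>I. w k0 = 1 \<and> (\<forall>k\<in>I - {k0}. e k = 0)"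
proof -
  obtain k0 where k0: "k0 \<in> I" "w k0 * e k0 \<noteq> 0"
    using one sum.neutral[of I "\<lambda>k. w k * e k"] by force
  have "(\<Sum>k\<in>I. w k * e k) = w k0 * e k0 + (\<Sum>k\<in>I - {k0}. w k * e k)"
    using I k0 by (simp add: sum.remove)
  then have "w k0 * e k0 = 1" and rest: "(\<Sum>k\<in>I - {k0}. w k * e k) = 0"
    using one k0 by linarith+
  moreover have "\<forall>k\<in>I - {k0}. e k = 0"
    by (rule weighted_sum_eq_zero[OF _ _ rest]) (use I pos in auto)
  ultimately show ?thesis using k0(1) by auto
qed

text \<open>The weighted sum \<open>?P\<close> of the lowest digits and \<open>d * e'\<close> are
  both at most \<open>d\<close>, so their congruence modulo \<open>d + 1\<close> is an equality. The
  extreme values 0 and \<open>d\<close> of \<open>?P\<close> force every lowest digit to equal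
  \<open>e'\<close>, and the quotients satisfy the same equation with the smaller
  \<open>s'\<close>.\<close>

lemma weighted_sum_balanced:
  fixes w :: "'a \<Rightarrow> nat"
  assumes I: "finite I" and pos: "\<forall>k\<in>I. 0 < w k"
    and d: "d = sum w I" "0 < d"
    and "\<And>k. k \<in> I \<Longrightarrow> t k \<in> binary_digit_numbers (d + 1)"
    and "v \<in> binary_digit_numbers (d + 1)"
    and "(\<Sum>k\<in>I. w k * t k) = d * v"
  shows "\<forall>k\<in>I. t k = v"
  using assms(5-)
proof (induction v arbitrary: t rule: less_induct)
  case (less v)
  show ?case
  proof (cases "v = 0")
    case True
    then show ?thesis using weighted_sum_eq_zero[OF I pos, of t] less.prems(3) by simp
  next
    case False
    obtain e s where
      "\<forall>k\<in>I. t k = e k + (d + 1) * s k \<and> e k \<le> 1 \<and> s k \<in> binary_digit_numbers (d + 1)"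
      using binary_digit_numbers_split_fun[of I t "d + 1"] less.prems(1) by blast
    then have es: "\<And>k. k \<in> I \<Longrightarrow> t k = e k + (d + 1) * s k"
      "\<And>k. k \<in> I \<Longrightarrow> e k \<le> 1" "\<And>k. k \<in> I \<Longrightarrow> s k \<in> binary_digit_numbers (d + 1)"
      by blast+
    obtain e' s' where es': "v = e' + (d + 1) * s'" "e' \<le> 1" "s' \<in> binary_digit_numbers (d + 1)"
      using binary_digit_numbers_split[OF less.prems(2)] by blast
    let ?P = "\<Sum>k\<in>I. w k * e k" and ?Q = "\<Sum>k\<in>I. w k * s k"
    have P: "?P \<le> d" unfolding d(1) by (rule sum_weighted_bits_le) (rule es(2))
    have compl: "?P + (\<Sum>k\<in>I. w k * (1 - e k)) = d"
      unfolding d(1) by (rule sum_weighted_bits_complement) (rule es(2))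
    have dig: "(\<Sum>k\<in>I. w k * t k) = ?P + (d + 1) * ?Q"
      by (rule sum_weighted_digits) (rule es(1))
    have Pe: "d * e' \<le> d" using es'(2) by simp
    have eq: "?P + (d + 1) * ?Q = d * e' + (d + 1) * (d * s')"
      using less.prems(3) unfolding dig es'(1) by (simp add: algebra_simps)
    have Peq: "?P = d * e'"
      using arg_cong[OF eq, of "\<lambda>x. x mod (d + 1)"] P Pe by (simp only: mod_mult_self2) simp
    have "(d + 1) * ?Q = (d + 1) * (d * s')" using eq unfolding Peq by linarith
    then have Qeq: "?Q = d * s'" by (simp only: Suc_eq_plus1[symmetric] Suc_mult_cancel1)
    have "s' < v" using False es'(1) d(2) by (cases "s' = 0") auto
    then have s: "\<forall>k\<in>I. s k = s'"
      using less.IH[of s' s] es(3) es'(3) Qeq by blast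
    have "e k = e'" if k: "k \<in> I" for k
    proof (cases "e' = 0")
      case True
      then show ?thesis using weighted_sum_eq_zero[OF I pos, of e] Peq k by simp
    next
      case False
      then have "e' = 1" using es'(2) by simp
      then have "(\<Sum>k\<in>I. w k * (1 - e k)) = 0"
        using compl Peq by simp
      then have "\<forall>k\<in>I. 1 - e k = 0" by (rule weighted_sum_eq_zero[OF I pos])
      then have "1 - e k = 0" using k by blast
      then show ?thesis using False es(2)[OF k] es'(2) by auto
    qed
    then show ?thesis using s es es' by auto
  qed
qed

text \<open>If the lowest digit of \<open>v\<close> is 0, then \<open>?P = d\<close>: all lowest
  digits are 1 and the deficit passes to the higher digits. If it is 1, then
  \<open>?P + 1 = d\<close>: a single index, of weight 1, has digit 0 and the higher digits
  balance.\<close>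

lemma weighted_sum_deficit_one:
  fixes w :: "'a \<Rightarrow> nat"
  assumes I: "finite I" and pos: "\<forall>k\<in>I. 0 < w k"
    and d: "d = sum w I" "0 < d"
    and "\<And>k. k \<in> I \<Longrightarrow> t k \<in> binary_digit_numbers (d + 1)"
    and "v \<in> binary_digit_numbers (d + 1)"
    and "(\<Sum>k\<in>I. w k * t k) + 1 = d * v"
  shows "\<exists>k0\<in>I. w k0 = 1 \<and> (\<exists>y. \<forall>k\<in>I - {k0}. t k = y)"
  using assms(5-)
proof (induction v arbitrary: t rule: less_induct)
  case (less v)
  obtain e s where
    "\<forall>k\<in>I. t k = e k + (d + 1) * s k \<and> e k \<le> 1 \<and> s k \<in> binary_digit_numbers (d + 1)"
    using binary_digit_numbers_split_fun[of I t "d + 1"] less.prems(1) by blast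
  then have es: "\<And>k. k \<in> I \<Longrightarrow> t k = e k + (d + 1) * s k"
    "\<And>k. k \<in> I \<Longrightarrow> e k \<le> 1" "\<And>k. k \<in> I \<Longrightarrow> s k \<in> binary_digit_numbers (d + 1)"
    by blast+
  obtain e' s' where es': "v = e' + (d + 1) * s'" "e' \<le> 1" "s' \<in> binary_digit_numbers (d + 1)"
    using binary_digit_numbers_split[OF less.prems(2)] by blast
  let ?P = "\<Sum>k\<in>I. w k * e k" and ?Q = "\<Sum>k\<in>I. w k * s k"
  have P: "?P \<le> d" unfolding d(1) by (rule sum_weighted_bits_le) (rule es(2))
  have compl: "?P + (\<Sum>k\<in>I. w k * (1 - e k)) = d"
    unfolding d(1) by (rule sum_weighted_bits_complement) (rule es(2))
  have dig: "(\<Sum>k\<in>I. w k * t k) = ?P + (d + 1) * ?Q"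
    by (rule sum_weighted_digits) (rule es(1))
  have eq: "?P + 1 + (d + 1) * ?Q = d * e' + (d + 1) * (d * s')"
    using less.prems(3) unfolding dig es'(1) by (simp add: algebra_simps)
  have md: "(?P + 1) mod (d + 1) = (d * e') mod (d + 1)"
    using arg_cong[OF eq, of "\<lambda>x. x mod (d + 1)"] by (simp only: mod_mult_self2)
  show ?case
  proof (cases "e' = 0")
    case True
    then have Pd: "?P = d"
      using md P by (cases "?P = d") auto
    have "(d + 1) * (1 + ?Q) = (d + 1) * (d * s')"
      using eq True Pd by (simp add: algebra_simps)
    then have Qeq: "?Q + 1 = d * s'" by (simp only: Suc_eq_plus1_left[symmetric] Suc_eq_plus1[symmetric] Suc_mult_cancel1)
    \<comment> \<open>Here \<open>s'\<close> is nonzero, since \<open>d * s'\<close> is a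
      successor.\<close>
    have "s' < v" using Qeq True es'(1) d(2) by (cases "s' = 0") auto
    then obtain k0 y where k0: "k0 \<in> I" "w k0 = 1" "\<forall>k\<in>I - {k0}. s k = y"
      using less.IH[of s' s] es(3) es'(3) Qeq by blast
    have "(\<Sum>k\<in>I. w k * (1 - e k)) = 0"
      using compl Pd by simp
    then have "\<forall>k\<in>I. 1 - e k = 0" by (rule weighted_sum_eq_zero[OF I pos])
    then have "e k = 1" if "k \<in> I" for k
      using es(2)[OF that] that by (meson diff_is_0_eq le_antisym)
    then have "\<forall>k\<in>I - {k0}. t k = 1 + (d + 1) * y" using es(1) k0(3) by auto
    then show ?thesis using k0 by blast
  next
    case False
    then have e': "e' = 1" using es'(2) by simp
    then have P1: "?P + 1 = d"
      using md P d(2) by (cases "?P = d") auto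
    then have "(d + 1) * ?Q = (d + 1) * (d * s')" using eq e' by (simp add: algebra_simps)
    then have "?Q = d * s'" by (simp only: Suc_eq_plus1[symmetric] Suc_mult_cancel1)
    then have s: "\<forall>k\<in>I. s k = s'"
      using weighted_sum_balanced[of I w d s s'] I pos d es(3) es'(3) by blast
    have "(\<Sum>k\<in>I. w k * (1 - e k)) = 1"
      using compl P1 by simp
    then obtain k0 where k0: "k0 \<in> I" "w k0 = 1" "\<forall>k\<in>I - {k0}. 1 - e k = 0"
      using sum_weighted_bits_eq_one[of I "\<lambda>k. 1 - e k" w] I pos by auto
    then have "\<forall>k\<in>I - {k0}. t k = 1 + (d + 1) * s'" using es(1,2) s by force
    then show ?thesis using k0 by blast
  qed
qed

text \<open>If the lowest digit of \<open>v\<close> is 0, then \<open>?P = 1\<close>: a single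
  index, of weight 1, has digit 1 and the higher digits balance. If it is 1, then
  \<open>d * e' + 1\<close> is one unit of the next place, so \<open>?P = 0\<close> and the excess
  passes on.\<close>

lemma weighted_sum_excess_one:
  fixes w :: "'a \<Rightarrow> nat"
  assumes I: "finite I" and pos: "\<forall>k\<in>I. 0 < w k"
    and d: "d = sum w I" "0 < d"
    and "\<And>k. k \<in> I \<Longrightarrow> t k \<in> binary_digit_numbers (d + 1)"
    and "v \<in> binary_digit_numbers (d + 1)"
    and "(\<Sum>k\<in>I. w k * t k) = d * v + 1"
  shows "\<exists>k0\<in>I. w k0 = 1 \<and> (\<exists>y. \<forall>k\<in>I - {k0}. t k = y)"
  using assms(5-)
proof (induction v arbitrary: t rule: less_induct)
  case (less v)
  obtain e s where
    "\<forall>k\<in>I. t k = e k + (d + 1) * s k \<and> e k \<le> 1 \<and> s k \<in> binary_digit_numbers (d + 1)"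
    using binary_digit_numbers_split_fun[of I t "d + 1"] less.prems(1) by blast
  then have es: "\<And>k. k \<in> I \<Longrightarrow> t k = e k + (d + 1) * s k"
    "\<And>k. k \<in> I \<Longrightarrow> e k \<le> 1" "\<And>k. k \<in> I \<Longrightarrow> s k \<in> binary_digit_numbers (d + 1)"
    by blast+
  obtain e' s' where es': "v = e' + (d + 1) * s'" "e' \<le> 1" "s' \<in> binary_digit_numbers (d + 1)"
    using binary_digit_numbers_split[OF less.prems(2)] by blast
  let ?P = "\<Sum>k\<in>I. w k * e k" and ?Q = "\<Sum>k\<in>I. w k * s k"
  have P: "?P \<le> d" unfolding d(1) by (rule sum_weighted_bits_le) (rule es(2))
  have dig: "(\<Sum>k\<in>I. w k * t k) = ?P + (d + 1) * ?Q"
    by (rule sum_weighted_digits) (rule es(1))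
  have eq: "?P + (d + 1) * ?Q = d * e' + 1 + (d + 1) * (d * s')"
    using less.prems(3) unfolding dig es'(1) by (simp add: algebra_simps)
  have md: "?P mod (d + 1) = (d * e' + 1) mod (d + 1)"
    using arg_cong[OF eq, of "\<lambda>x. x mod (d + 1)"] by (simp only: mod_mult_self2)
  show ?case
  proof (cases "e' = 0")
    case True
    then have P1: "?P = 1"
      using md P d(2) by auto
    then have "(d + 1) * ?Q = (d + 1) * (d * s')" using eq True by (simp add: algebra_simps)
    then have "?Q = d * s'" by (simp only: Suc_eq_plus1[symmetric] Suc_mult_cancel1)
    then have s: "\<forall>k\<in>I. s k = s'"
      using weighted_sum_balanced[of I w d s s'] I pos d es(3) es'(3) by blast
    obtain k0 where k0: "k0 \<in> I" "w k0 = 1" "\<forall>k\<in>I - {k0}. e k = 0"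
      using sum_weighted_bits_eq_one[of I e w] I pos es(2) P1 by blast
    then have "\<forall>k\<in>I - {k0}. t k = (d + 1) * s'" using es(1) s by force
    then show ?thesis using k0 by blast
  next
    case False
    then have e': "e' = 1" using es'(2) by simp
    then have P0: "?P = 0"
      using md P by auto
    have "(d + 1) * ?Q = (d + 1) * (d * s' + 1)"
      using eq e' P0 by (simp add: algebra_simps)
    then have Qeq: "?Q = d * s' + 1" by (simp only: Suc_eq_plus1[symmetric] Suc_mult_cancel1)
    have "s' < v" using es'(1) e' d(2) by (cases "s' = 0") auto
    then obtain k0 y where k0: "k0 \<in> I" "w k0 = 1" "\<forall>k\<in>I - {k0}. s k = y"
      using less.IH[of s' s] es(3) es'(3) Qeq by blast
    have "\<forall>k\<in>I. e k = 0" by (rule weighted_sum_eq_zero[OF I pos P0])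
    then have "\<forall>k\<in>I - {k0}. t k = (d + 1) * y" using es(1) k0(3) by auto
    then show ?thesis using k0 by blast
  qed
qed

section \<open>Rearrangement bounds for distinct natural numbers\<close>

lemma sum_lessThan_card_le:
  fixes X :: "nat set"
  assumes "finite X"
  shows "(\<Sum>i<card X. i) \<le> \<Sum>X"
  using assms
proof (induction "card X" arbitrary: X)
  case 0
  then show ?case by simp
next
  case (Suc n)
  then have ne: "X \<noteq> {}" by auto
  have mem: "Max X \<in> X" using Suc ne by simp
  then have card: "card (X - {Max X}) = n" using Suc by simp
  have "X \<subseteq> {..Max X}" using Suc.prems by auto
  then have "card X \<le> Max X + 1" using card_mono[of "{..Max X}" X] by simp
  moreover have "(\<Sum>i<n. i) \<le> \<Sum>(X - {Max X})"
    using Suc.hyps(1)[of "X - {Max X}"] card Suc.prems by simp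
  moreover have "\<Sum>X = Max X + \<Sum>(X - {Max X})"
    using Suc.prems mem by (simp add: sum.remove)
  ultimately show ?case using Suc.hyps(2)[symmetric] by simp
qed

text \<open>The smallest weight \<open>w a\<close> is split off from all weights. Its share is
  bounded because distinct naturals sum to at least 0 + 1 + 2 + ...; the remaining weights vanish at
  \<open>a\<close>, are still nondecreasing, and fall under the induction hypothesis for the shorter
  interval.\<close>

lemma rearrangement_lower_bound:
  fixes w r :: "nat \<Rightarrow> nat"
  assumes "\<And>k l. a \<le> k \<Longrightarrow> k \<le> l \<Longrightarrow> l \<le> b \<Longrightarrow> w k \<le> w l"
    and "inj_on r {a..b}"
  shows "(\<Sum>k=a..b. w k * (b - k)) \<le> (\<Sum>k=a..b. w k * r k)"
  using assms
proof (induction "Suc b - a" arbitrary: a w)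
  case 0
  then show ?case by simp
next
  case (Suc n)
  then have ab: "a \<le> b" by simp
  have split: "(\<Sum>k=a..b. w k * f k) = w a * (\<Sum>k=a..b. f k) + (\<Sum>k=Suc a..b. (w k - w a) * f k)"
    for f :: "nat \<Rightarrow> nat"
  proof -
    have "(\<Sum>k=a..b. w k * f k) = (\<Sum>k=a..b. w a * f k + (w k - w a) * f k)"
      using Suc.prems(1)[of a] by (intro sum.cong) (auto simp flip: distrib_right)
    also have "\<dots> = w a * (\<Sum>k=a..b. f k) + (\<Sum>k=a..b. (w k - w a) * f k)"
      by (simp add: sum.distrib sum_distrib_left)
    finally show ?thesis using ab by (simp add: sum.atLeast_Suc_atMost)
  qed
  have "(\<Sum>k=a..b. b - k) = (\<Sum>i<Suc b - a. i)"
    using ab by (intro sum.reindex_bij_witness[of _ "\<lambda>i. b - i" "\<lambda>k. b - k"]) auto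
  also have "\<dots> = (\<Sum>i<card (r ` {a..b}). i)"
    using card_image[OF Suc.prems(2)] by simp
  also have "\<dots> \<le> \<Sum>(r ` {a..b})" by (intro sum_lessThan_card_le) simp
  also have "\<dots> = (\<Sum>k=a..b. r k)" using Suc.prems(2) by (simp add: sum.reindex)
  finally have 1: "w a * (\<Sum>k=a..b. b - k) \<le> w a * (\<Sum>k=a..b. r k)" by simp
  have "inj_on r {Suc a..b}" by (rule inj_on_subset[OF Suc.prems(2)]) auto
  then have "(\<Sum>k=Suc a..b. (w k - w a) * (b - k)) \<le> (\<Sum>k=Suc a..b. (w k - w a) * r k)"
    using Suc.hyps(2) Suc.prems(1)
    by (intro Suc.hyps(1)) (auto intro!: diff_le_mono)
  then show ?case unfolding split using 1 by (intro add_mono)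
qed

text \<open>Adapted to the unbalanced cases, where nothing is known about the value at one index
  \<open>k0\<close> of minimal weight.\<close>

lemma rearrangement_lower_bound_except:
  fixes w r :: "nat \<Rightarrow> nat"
  assumes mono: "\<And>k l. 1 \<le> k \<Longrightarrow> k \<le> l \<Longrightarrow> l \<le> b \<Longrightarrow> w k \<le> w l"
    and k0: "k0 \<in> {1..b}" "w k0 = w 1"
    and inj: "inj_on r ({1..b} - {k0})"
  shows "(\<Sum>k=2..b. w k * (b - k)) \<le> (\<Sum>k=1..b. w k * r k)"
proof -
  \<comment> \<open>As \<open>k0\<close> and 1 have the same weight, \<open>r 1\<close> may be moved to the place \<open>k0\<close>.\<close>
  define r' where "r' = r(k0 := r 1)"
  have "inj_on r' {2..b}"
  proof (rule inj_onI)
    fix k l assume kl: "k \<in> {2..b}" "l \<in> {2..b}" "r' k = r' l"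
    \<comment> \<open>\<open>?s\<close> gives the index from which \<open>r'\<close> takes its
      value; it is injective on \<open>{2..b}\<close> because 1 lies outside.\<close>
    let ?s = "\<lambda>k. if k = k0 then 1 else k"
    have "r (?s k) = r (?s l)" using kl(3) by (simp add: r'_def split: if_splits)
    moreover have "?s k \<in> {1..b} - {k0}" "?s l \<in> {1..b} - {k0}" if "k \<noteq> l"
      using kl k0 that by auto
    ultimately have "?s k = ?s l" if "k \<noteq> l" using inj_onD[OF inj] that by blast
    then show "k = l" using kl(1,2) by (cases "k = l") (auto split: if_splits)
  qed
  then have "(\<Sum>k=2..b. w k * (b - k)) \<le> (\<Sum>k=2..b. w k * r' k)"
    using mono by (intro rearrangement_lower_bound) auto
  also have "\<dots> \<le> (\<Sum>k=1..b. w k * r k)"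
  proof (cases "k0 = 1")
    case True
    then have "r' = r" by (simp add: r'_def)
    then show ?thesis by (auto intro!: sum_mono2)
  next
    case False
    then have mem: "k0 \<in> {2..b}" using k0 by auto
    have "(\<Sum>k=2..b. w k * r' k) = w k0 * r' k0 + (\<Sum>k\<in>{2..b} - {k0}. w k * r' k)"
      by (rule sum.remove) (use mem in auto)
    also have "\<dots> = w 1 * r 1 + (\<Sum>k\<in>{2..b} - {k0}. w k * r k)"
      using k0 by (auto simp: r'_def intro!: sum.cong)
    also have "\<dots> = (\<Sum>k\<in>insert 1 ({2..b} - {k0}). w k * r k)"
      by (subst sum.insert) auto
    \<comment> \<open>Only the term at \<open>k0\<close> has been left out.\<close>
    also have "\<dots> \<le> (\<Sum>k=1..b. w k * r k)"
      using mem by (intro sum_mono2) auto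
    finally show ?thesis .
  qed
  finally show ?thesis .
qed

section \<open>Invariance of the equation and the greedy recursion\<close>

lemma has_distinct_solution_mono:
  "has_distinct_solution E X \<Longrightarrow> X \<subseteq> Y \<Longrightarrow> has_distinct_solution E Y"
  unfolding has_distinct_solution_def by blast

text \<open>The coefficients on either side have total \<open>sum_list E\<close>, so a shift changes
  both sides equally.\<close>

lemma has_distinct_solution_translate:
  assumes "has_distinct_solution E X"
  shows "has_distinct_solution E ((+) s ` X)"
proof -
  obtain x :: "nat \<Rightarrow> nat" where x: "x ` {1..length E + 1} \<subseteq> X" "inj_on x {1..length E + 1}"
    "(\<Sum>k=1..length E. coeff E k * x k) = sum_list E * x (length E + 1)"
    using assms unfolding has_distinct_solution_def by blast
  have "(\<Sum>k=1..length E. coeff E k * (s + x k)) = sum_list E * (s + x (length E + 1))"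
    using x(3) sum_coeff[of E] by (simp add: distrib_left sum.distrib flip: sum_distrib_right)
  then show ?thesis
    unfolding has_distinct_solution_def using x(1,2)
    by (intro exI[of _ "\<lambda>k. s + x k"]) (auto simp: inj_on_def)
qed

lemma strict_mono_greedy_seq:
  assumes "valid_tuple E"
  shows "strict_mono (greedy_seq E)"
  using greedy_seq_Suc[OF assms] by (simp add: strict_mono_Suc_iff)

text \<open>Membership of \<open>n\<close> is expressed through the smaller terms alone, so that
  another set can be compared with the range by strong induction. A skipped \<open>n\<close> lies
  strictly between two consecutive terms; without a solution it would have been a candidate for the
  \<open>LEAST\<close>.\<close>

lemma in_range_greedy_seq_iff:
  assumes E: "valid_tuple E"
  shows "n \<in> range (greedy_seq E) \<longleftrightarrow>
    \<not> has_distinct_solution E (insert n {s \<in> range (greedy_seq E). s < n})"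
proof
  note mono = strict_mono_greedy_seq[OF E]
  assume "n \<in> range (greedy_seq E)"
  then obtain i where i: "n = greedy_seq E i" by blast
  have "insert n {s \<in> range (greedy_seq E). s < n} \<subseteq> greedy_seq E ` {..Suc i}"
    using strict_mono_less[OF mono] i by auto
  then show "\<not> has_distinct_solution E (insert n {s \<in> range (greedy_seq E). s < n})"
    using greedy_seq_Suc[OF E] has_distinct_solution_mono by blast
next
  note mono = strict_mono_greedy_seq[OF E]
  assume no: "\<not> has_distinct_solution E (insert n {s \<in> range (greedy_seq E). s < n})"
  show "n \<in> range (greedy_seq E)"
  proof (rule ccontr)
    assume out: "n \<notin> range (greedy_seq E)"
    define i where "i = (LEAST i. n < greedy_seq E i)"
    have "n < greedy_seq E (Suc n)"
      using strict_mono_imp_increasing[OF mono, of "Suc n"] by simp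
    then have i: "n < greedy_seq E i" unfolding i_def by (rule LeastI)
    then obtain k where k: "i = Suc k" by (cases i) auto
    have "\<not> n < greedy_seq E k"
      using not_less_Least[of k "\<lambda>i. n < greedy_seq E i"] k i_def by simp
    then have lt: "greedy_seq E k < n" using out by (metis linorder_neqE_nat rangeI)
    have "greedy_seq E ` {..k} \<subseteq> {s \<in> range (greedy_seq E). s < n}"
      using strict_mono_less_eq[OF mono] lt by (auto intro: le_less_trans)
    then have "\<not> has_distinct_solution E (insert n (greedy_seq E ` {..k}))"
      using no has_distinct_solution_mono by (metis insert_mono)
    then have "greedy_seq E (Suc k) \<le> n"
      using lt unfolding greedy_seq.simps by (intro Least_le) auto
    then show False using i k by simp
  qed
qed

section \<open>Solving the equation digit by digit\<close>

text \<open>A digit \<open>e > 0\<close> of \<open>u\<close> is balanced by digits 1 at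
  \<open>p\<close> and on a set \<open>H\<close> of weight \<open>d - e\<close>, since
  \<open>e + (d - e) = d\<close>; a digit 0 is balanced by zeros. No digit used exceeds
  \<open>e\<close>, which gives \<open>t k \<le> u\<close>.\<close>

lemma digitwise_solution:
  fixes w :: "nat \<Rightarrow> nat"
  assumes K: "finite K" "p \<notin> K" and d: "d = 1 + sum w K"
    and subset_sums: "\<And>j. j \<le> sum w K \<Longrightarrow> \<exists>H\<subseteq>K. sum w H = j"
  shows "\<exists>t. (\<forall>k\<in>insert p K. t k \<in> binary_digit_numbers (d + 1) \<and> t k \<le> u) \<and>
    u + (\<Sum>k\<in>K. w k * t k) = d * t p"
proof (induction u rule: less_induct)
  case (less u)
  show ?case
  proof (cases "u = 0")
    case True
    then show ?thesis
      by (intro exI[of _ "\<lambda>_. 0"]) (auto intro: binary_digit_numbers.zero)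
  next
    case False
    define v e where "v = u div (d + 1)" and "e = u mod (d + 1)"
    have u: "u = e + (d + 1) * v" unfolding v_def e_def by (rule mod_mult_div_eq[symmetric])
    have e: "e \<le> d" unfolding e_def using mod_less_divisor[of "d + 1" u] by simp
    have "v < u" using False d unfolding v_def by (intro div_less_dividend) auto
    then obtain s where s: "\<forall>k\<in>insert p K. s k \<in> binary_digit_numbers (d + 1) \<and> s k \<le> v"
      "v + (\<Sum>k\<in>K. w k * s k) = d * s p"
      using less.IH by blast
    obtain g where g: "\<forall>k. g k \<le> (1::nat) \<and> g k \<le> e" "e + (\<Sum>k\<in>K. w k * g k) = d * g p"
    proof (cases "e = 0")
      case True
      show thesis using True by (intro that[of "\<lambda>_. 0"]) auto
    next
      case False
      then obtain H where H: "H \<subseteq> K" "sum w H = d - e"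
        using subset_sums[of "d - e"] d by fastforce
      have "(\<Sum>k\<in>K. w k * of_bool (k \<in> insert p H)) = (\<Sum>k\<in>H. w k)"
        using H K by (intro sum.mono_neutral_cong_right) auto
      then show thesis using False H(2) e
        by (intro that[of "\<lambda>k. of_bool (k \<in> insert p H)"]) auto
    qed
    show ?thesis
    proof (intro exI[of _ "\<lambda>k. g k + (d + 1) * s k"] conjI ballI)
      fix k assume "k \<in> insert p K"
      then have k: "s k \<in> binary_digit_numbers (d + 1)" "s k \<le> v" using s by auto
      show "g k + (d + 1) * s k \<in> binary_digit_numbers (d + 1)"
        using k g by (intro binary_digit_numbers.step) auto
      show "g k + (d + 1) * s k \<le> u"
        unfolding u using k g by (intro add_mono mult_le_mono) auto
    next
      have "u + (\<Sum>k\<in>K. w k * (g k + (d + 1) * s k)) =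
          (e + (\<Sum>k\<in>K. w k * g k)) + (d + 1) * (v + (\<Sum>k\<in>K. w k * s k))"
        unfolding u by (subst sum_weighted_digits[OF refl]) (simp add: algebra_simps)
      then show "u + (\<Sum>k\<in>K. w k * (g k + (d + 1) * s k)) = d * (g p + (d + 1) * s p)"
        unfolding g s by (simp add: algebra_simps)
    qed
  qed
qed

text \<open>The lowest digit \<open>e \<ge> 2\<close> of \<open>u\<close> determines
  \<open>j = d - e\<close>. At that place the digit is 1 on \<open>insert p H\<close> and 0 on
  \<open>K - H\<close>, which separates the two classes and keeps every \<open>t k\<close> below
  \<open>u\<close>. The number \<open>j\<close> is fixed before \<open>H\<close>, because hypothesis
  (ii) chooses \<open>H\<close> only after \<open>j\<close>.\<close>

lemma separated_digitwise_solution: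
  fixes w :: "nat \<Rightarrow> nat"
  assumes K: "finite K" "p \<notin> K" and d: "d = 1 + sum w K"
    and subset_sums: "\<And>j. j \<le> sum w K \<Longrightarrow> \<exists>H\<subseteq>K. sum w H = j"
    and u: "u \<notin> binary_digit_numbers (d + 1)"
  shows "\<exists>j. j + 2 \<le> d \<and> (\<forall>H\<subseteq>K. sum w H = j \<longrightarrow>
    (\<exists>t. (\<forall>k\<in>insert p K. t k \<in> binary_digit_numbers (d + 1) \<and> t k < u) \<and>
      u + (\<Sum>k\<in>K. w k * t k) = d * t p \<and> (\<forall>k\<in>insert p H. \<forall>l\<in>K - H. t k \<noteq> t l)))"
  using u
proof (induction u rule: less_induct)
  case (less u)
  define v e where "v = u div (d + 1)" and "e = u mod (d + 1)"
  have u: "u = e + (d + 1) * v" unfolding v_def e_def by (rule mod_mult_div_eq[symmetric])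
  have e: "e \<le> d" unfolding e_def using mod_less_divisor[of "d + 1" u] by simp
  have u0: "u \<noteq> 0" using less.prems binary_digit_numbers.zero by metis
  show ?case
  proof (cases "e \<le> 1")
    case True
    then have v: "v \<notin> binary_digit_numbers (d + 1)"
      using less.prems binary_digit_numbers.step u by blast
    have "v < u" using u0 d unfolding v_def by (intro div_less_dividend) auto
    then obtain j where j: "j + 2 \<le> d" and jH: "\<And>H. H \<subseteq> K \<Longrightarrow> sum w H = j \<Longrightarrow>
      \<exists>t. (\<forall>k\<in>insert p K. t k \<in> binary_digit_numbers (d + 1) \<and> t k < v) \<and>
      v + (\<Sum>k\<in>K. w k * t k) = d * t p \<and> (\<forall>k\<in>insert p H. \<forall>l\<in>K - H. t k \<noteq> t l)"
      using less.IH v by blast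
    show ?thesis
    proof (intro exI[of _ j] conjI allI impI j)
      fix H assume "H \<subseteq> K" "sum w H = j"
      then obtain s where s: "\<forall>k\<in>insert p K. s k \<in> binary_digit_numbers (d + 1) \<and> s k < v"
        "v + (\<Sum>k\<in>K. w k * s k) = d * s p" "\<forall>k\<in>insert p H. \<forall>l\<in>K - H. s k \<noteq> s l"
        using jH by blast
      \<comment> \<open>A digit 0 or 1 is copied to every index; it balances because
        \<open>1 + sum w K = d\<close>.\<close>
      have "u + (\<Sum>k\<in>K. w k * (e + (d + 1) * s k)) =
          (e + (\<Sum>k\<in>K. w k * e)) + (d + 1) * (v + (\<Sum>k\<in>K. w k * s k))"
        unfolding u by (subst sum_weighted_digits[OF refl]) (simp add: algebra_simps)
      also have "\<dots> = d * (e + (d + 1) * s p)"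
        unfolding s(2) d sum_distrib_right[symmetric] by (simp add: algebra_simps)
      finally show "\<exists>t. (\<forall>k\<in>insert p K. t k \<in> binary_digit_numbers (d + 1) \<and> t k < u) \<and>
        u + (\<Sum>k\<in>K. w k * t k) = d * t p \<and> (\<forall>k\<in>insert p H. \<forall>l\<in>K - H. t k \<noteq> t l)"
        using s True
        by (intro exI[of _ "\<lambda>k. e + (d + 1) * s k"])
          (auto simp: u simp del: mult_Suc intro: binary_digit_numbers.step[simplified])
    qed
  next
    case False
    obtain s where s: "\<forall>k\<in>insert p K. s k \<in> binary_digit_numbers (d + 1) \<and> s k \<le> v"
      "v + (\<Sum>k\<in>K. w k * s k) = d * s p"
      using digitwise_solution[OF K d subset_sums] by blast
    show ?thesis
    proof (intro exI[of _ "d - e"] conjI allI impI)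
      show "d - e + 2 \<le> d" using False e by simp
      fix H assume H: "H \<subseteq> K" "sum w H = d - e"
      define g :: "nat \<Rightarrow> nat" where "g k = of_bool (k \<in> insert p H)" for k
      have "(\<Sum>k\<in>K. w k * g k) = (\<Sum>k\<in>H. w k)"
        unfolding g_def using H K by (intro sum.mono_neutral_cong_right) auto
      then have g: "e + (\<Sum>k\<in>K. w k * g k) = d * g p" using H e by (simp add: g_def)
      have "u + (\<Sum>k\<in>K. w k * (g k + (d + 1) * s k)) =
          (e + (\<Sum>k\<in>K. w k * g k)) + (d + 1) * (v + (\<Sum>k\<in>K. w k * s k))"
        unfolding u by (subst sum_weighted_digits[OF refl]) (simp add: algebra_simps)
      then have eq: "u + (\<Sum>k\<in>K. w k * (g k + (d + 1) * s k)) = d * (g p + (d + 1) * s p)"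
        unfolding g s by (simp add: algebra_simps)
      have lt: "g k + (d + 1) * s k < u" if "k \<in> insert p K" for k
        unfolding u using that s False
        by (intro add_less_le_mono mult_le_mono) (auto simp: g_def)
      have mem: "g k + (d + 1) * s k \<in> binary_digit_numbers (d + 1)" if "k \<in> insert p K" for k
        using that s by (intro binary_digit_numbers.step) (auto simp: g_def)
      have "g k + (d + 1) * s k \<noteq> g l + (d + 1) * s l" if "k \<in> insert p H" "l \<in> K - H" for k l
      proof
        assume "g k + (d + 1) * s k = g l + (d + 1) * s l"
        then have "g k mod (d + 1) = g l mod (d + 1)"
          by (metis mod_mult_self2)
        moreover have "g k = 1" "g l = 0" using that K by (auto simp: g_def)
        ultimately show False using d by simp
      qed
      then show "\<exists>t. (\<forall>k\<in>insert p K. t k \<in> binary_digit_numbers (d + 1) \<and> t k < u) \<and>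
        u + (\<Sum>k\<in>K. w k * t k) = d * t p \<and> (\<forall>k\<in>insert p H. \<forall>l\<in>K - H. t k \<noteq> t l)"
        using eq lt mem by (intro exI[of _ "\<lambda>k. g k + (d + 1) * s k"]) blast
    qed
  qed
qed

section \<open>The set \<open>A\<close> satisfies the greedy recursion\<close>

theorem theorem3:
  fixes E :: "nat list" and m d z c :: nat and a :: "nat \<Rightarrow> nat" and R :: "nat set"
  assumes valid: "valid_tuple E"
    and m: "m = length E + 1"
    and d: "d = sum_list E"
    and a: "a = greedy_seq E"
    and z: "0 < z"
    and R: "R = a ` {0..z}"
    and c: "c = a (z + 1)"
    and i: "int c = 1 + int d * int (Max R)
              - (\<Sum>k=2..m-1. int (coeff E k) * (int m - int k - 1))"
    and ii: "\<And>r1 j :: nat. r1 < c \<Longrightarrow> j + 2 \<le> d \<Longrightarrow>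
      \<exists>H (r :: nat \<Rightarrow> nat). H \<subseteq> {2..m-1} \<and> r 1 = r1 \<and> (\<forall>k\<in>{2..m}. r k \<in> R) \<and>
        (\<Sum>k\<in>H. coeff E k) = j \<and>
        (\<Sum>k=1..m-1. coeff E k * r k) = d * r m \<and>
        inj_on r (H \<union> {m}) \<and> inj_on r ({2..m-1} - H)"
  shows "\<forall>n. \<exists>(t :: nat \<Rightarrow> nat) r. (\<forall>i. t i \<in> {0, 1}) \<and> finite {i. t i \<noteq> 0} \<and> r \<in> R \<and>
    a n = c * (\<Sum>i | t i \<noteq> 0. t i * (d + 1) ^ i) + r"
proof -
  let ?T = "binary_digit_numbers (d + 1)"
  let ?w = "coeff E"
  define b where "b = length E"
  have mb: "m = Suc b" "m - 1 = b" using m by (auto simp: b_def)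
  have b1: "1 \<le> b" using valid unfolding b_def valid_tuple_def by (cases E) auto
  have pos: "0 < ?w k" if "k \<in> {1..b}" for k using coeff_pos[OF valid] that by (simp add: b_def)
  have w1: "?w 1 = 1" using valid by (simp add: valid_tuple_def)
  have mono: "?w k \<le> ?w l" if "1 \<le> k" "k \<le> l" "l \<le> b" for k l
    using valid that unfolding valid_tuple_def coeff_def b_def by (auto intro: sorted_nth_mono)
  have dw: "d = sum ?w {1..b}" using d sum_coeff[of E] by (simp add: b_def)
  have dw2: "d = 1 + sum ?w {2..b}"
    using dw b1 w1 by (simp add: sum.atLeast_Suc_atMost numeral_2_eq_2)
  have d0: "0 < d" using dw2 by simp
  have amono: "strict_mono a" using strict_mono_greedy_seq[OF valid] a by simp
  define M where "M = a z"
  have RM: "R \<subseteq> {..M}"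
    using R strict_mono_less_eq[OF amono] by (auto simp: M_def)
  have "M \<in> R" using R by (auto simp: M_def)
  then have MaxR: "Max R = M" using RM R by (intro Max_eqI) auto
  have Rc: "r < c" if "r \<in> R" for r
    using that R c strict_mono_less[OF amono] by auto
  have c0: "0 < c" using c strict_mono_less[OF amono, of 0 "z + 1"] by simp
  have Rno: "\<not> has_distinct_solution E R"
  proof
    assume "has_distinct_solution E R"
    moreover have "R \<subseteq> greedy_seq E ` {..Suc z}" using R a by auto
    ultimately show False using greedy_seq_Suc[OF valid, of z] has_distinct_solution_mono by blast
  qed

  \<comment> \<open>The sum subtracted in (i), with \<open>b = m - 1\<close>. It is also the
    rearrangement minimum over \<open>{2..b}\<close>.\<close>
  define W where "W = (\<Sum>k=2..b. ?w k * (b - k))"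
  have "(\<Sum>k=2..m-1. int (?w k) * (int m - int k - 1)) = int W"
    unfolding W_def mb of_nat_sum by (intro sum.cong) (auto simp: of_nat_diff)
  then have "int c + int W = 1 + int d * int M" using i MaxR by simp
  then have cW: "c + W = 1 + d * M"
    by (metis of_nat_1 of_nat_add of_nat_eq_iff of_nat_mult)

  \<comment> \<open>For \<open>d \<ge> 2\<close>, (ii) with \<open>j = 0\<close> forces
    \<open>H = {}\<close>, so \<open>R\<close> contains \<open>b - 1\<close> distinct values and
    \<open>b - 2 \<le> M\<close>. Comparing \<open>W\<close> with the reversed arrangement pairs
    \<open>b - k\<close> with \<open>k - 2\<close>, whose sum is \<open>b - 2\<close>. For
    \<open>d = 1\<close> there are no weights beyond the first.\<close>
  have "2 * W \<le> d * M"
  proof (cases "d \<ge> 2")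
    case True
    obtain H r where H: "H \<subseteq> {2..b}" "\<forall>k\<in>{2..m}. r k \<in> R" "(\<Sum>k\<in>H. ?w k) = 0"
      "inj_on r ({2..b} - H)"
      using ii[OF c0, of 0] True unfolding mb by auto
    have "finite H" using H(1) finite_subset by blast
    then have "\<forall>k\<in>H. ?w k = 0" using H(3) by simp
    have "k \<notin> H" for k
    proof
      assume k: "k \<in> H"
      then have "k \<in> {1..b}" using H(1) by auto
      then show False using pos[of k] \<open>\<forall>k\<in>H. ?w k = 0\<close> k by simp
    qed
    then have "H = {}" by blast
    then have "card (r ` {2..b}) = b - 1" using H(4) by (simp add: card_image)
    moreover have "r ` {2..b} \<subseteq> {..M}" using H(2) RM mb by auto
    ultimately have M: "b - 2 \<le> M" using card_mono[of "{..M}" "r ` {2..b}"] by simp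
    have "W \<le> (\<Sum>k=2..b. ?w k * (k - 2))"
      unfolding W_def using mono by (intro rearrangement_lower_bound) (auto simp: inj_on_def)
    then have "2 * W \<le> (\<Sum>k=2..b. ?w k * (b - k) + ?w k * (k - 2))"
      by (simp add: W_def sum.distrib)
    also have "\<dots> = (\<Sum>k=2..b. ?w k * (b - 2))"
      by (intro sum.cong) (auto simp flip: distrib_left)
    also have "\<dots> \<le> d * M" unfolding sum_distrib_right[symmetric]
      using M dw2 by (intro mult_le_mono) auto
    finally show ?thesis .
  next
    case False
    then have "sum ?w {2..b} = 0" using dw2 by linarith
    then have "\<forall>k\<in>{2..b}. ?w k = 0" by simp
    then show ?thesis by (simp add: W_def)
  qed
  then have cM: "d * M < 2 * c" using cW by simp

  define A where "A = {c * t + r | t r. t \<in> ?T \<and> r \<in> R}"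
  have Ano: "\<not> has_distinct_solution E A"
  proof
    assume "has_distinct_solution E A"
    then obtain x where x: "x ` {1..m} \<subseteq> A" "inj_on x {1..m}"
      "(\<Sum>k=1..b. ?w k * x k) = d * x m"
      unfolding has_distinct_solution_def m b_def d by blast
    have "\<forall>k\<in>{1..m}. \<exists>t r. x k = c * t + r \<and> t \<in> ?T \<and> r \<in> R"
      using x(1) unfolding A_def by blast
    then obtain t r where tr: "\<And>k. k \<in> {1..m} \<Longrightarrow> x k = r k + c * t k"
      "\<And>k. k \<in> {1..m} \<Longrightarrow> t k \<in> ?T" "\<And>k. k \<in> {1..m} \<Longrightarrow> r k \<in> R"
      by (metis add.commute)
    have mm: "m \<in> {1..m}" "\<And>k. k \<in> {1..b} \<Longrightarrow> k \<in> {1..m}" using mb by auto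
    have posB: "\<forall>k\<in>{1..b}. 0 < ?w k" using pos by blast
    have tT: "t k \<in> ?T" if "k \<in> {1..b}" for k using tr(2) mm(2) that by blast
    have rM: "r k \<le> M" if "k \<in> {1..m}" for k using tr(3)[OF that] RM by auto
    \<comment> \<open>Quotient parts \<open>P\<close>, \<open>Q\<close> and remainder parts
      \<open>U\<close>, \<open>V\<close> of the two sides. Both \<open>U\<close> and
      \<open>V\<close> are at most \<open>d * M < 2 * c\<close>, so \<open>P\<close> and
      \<open>Q\<close> differ by at most 1.\<close>
    define P Q U V where "P = (\<Sum>k=1..b. ?w k * t k)" and "Q = d * t m"
      and "U = (\<Sum>k=1..b. ?w k * r k)" and "V = d * r m"
    have UVeq: "U + c * P = V + c * Q"
    proof -
      have "(\<Sum>k=1..b. ?w k * x k) = U + c * P"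
        unfolding U_def P_def using mm tr(1) by (intro sum_weighted_digits) auto
      then show ?thesis using x(3) tr(1)[OF mm(1)] by (simp add: V_def Q_def algebra_simps)
    qed
    have V: "V \<le> d * M" using rM[OF mm(1)] by (simp add: V_def)
    \<comment> \<open>The reflection \<open>M - r k\<close> turns lower bounds for weighted sums
      into upper bounds for \<open>U\<close>.\<close>
    have Ucomp: "U + (\<Sum>k=1..b. ?w k * (M - r k)) = d * M"
    proof -
      have "?w k * r k + ?w k * (M - r k) = ?w k * M" if "k \<in> {1..b}" for k
        using rM[OF mm(2)[OF that]] by (simp flip: distrib_left)
      then have "(\<Sum>k=1..b. ?w k * r k + ?w k * (M - r k)) = (\<Sum>k=1..b. ?w k * M)"
        by (intro sum.cong) auto
      then show ?thesis unfolding U_def dw sum.distrib sum_distrib_right .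
    qed
    \<comment> \<open>Where the quotients agree, the distinctness of the \<open>x k\<close> must
      come from the remainders.\<close>
    have injr: "inj_on r J" if "J \<subseteq> {1..m}" "\<forall>k\<in>J. t k = y" for J y
    proof (rule inj_onI)
      fix k l assume kl: "k \<in> J" "l \<in> J" "r k = r l"
      then have "x k = x l" using that tr(1) by (metis subsetD)
      then show "k = l" using x(2) that(1) kl by (auto dest: inj_onD)
    qed
    consider "P = Q" | "P + 1 = Q" | "P = Q + 1"
    proof -
      have "\<not> P + 2 \<le> Q"
      proof
        assume "P + 2 \<le> Q"
        then have "c * (P + 2) \<le> c * Q" by (rule mult_le_mono2)
        then show False using UVeq Ucomp cM by (simp add: algebra_simps)
      qed
      moreover have "\<not> Q + 2 \<le> P"
      proof
        assume "Q + 2 \<le> P"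
        then have "c * (Q + 2) \<le> c * P" by (rule mult_le_mono2)
        then show False using UVeq V cM by (simp add: algebra_simps)
      qed
      ultimately show thesis using that by linarith
    qed
    then show False
    proof cases
      case 1
      have "\<forall>k\<in>{1..b}. t k = t m"
        by (rule weighted_sum_balanced[OF _ posB dw d0 tT tr(2)[OF mm(1)]])
          (use 1 in \<open>auto simp: P_def Q_def\<close>)
      moreover have "{1..m} = insert m {1..b}" using mb by auto
      ultimately have "\<forall>k\<in>{1..m}. t k = t m" by (metis insertE)
      then have "inj_on r {1..m}" by (rule injr[OF subset_refl])
      moreover have "U = V" using UVeq 1 by simp
      ultimately have "has_distinct_solution E R"
        using tr(3) unfolding has_distinct_solution_def U_def V_def m b_def d by blast
      then show False using Rno by blast
    next
      case 2
      have "\<exists>k0\<in>{1..b}. ?w k0 = 1 \<and> (\<exists>y. \<forall>k\<in>{1..b} - {k0}. t k = y)"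
        by (rule weighted_sum_deficit_one[OF _ posB dw d0 tT tr(2)[OF mm(1)]])
          (use 2 in \<open>auto simp: P_def Q_def\<close>)
      then obtain k0 y where k0: "k0 \<in> {1..b}" "?w k0 = 1" "\<forall>k\<in>{1..b} - {k0}. t k = y" by blast
      then have inj: "inj_on r ({1..b} - {k0})" using mb by (intro injr[OF _ k0(3)]) auto
      \<comment> \<open>The bound for the reflected values gives
        \<open>U \<le> d * M - W = c - 1\<close>, against \<open>U = V + c\<close>.\<close>
      have "inj_on (\<lambda>k. M - r k) ({1..b} - {k0})"
      proof (rule inj_onI)
        fix k l assume kl: "k \<in> {1..b} - {k0}" "l \<in> {1..b} - {k0}" "M - r k = M - r l"
        then have "k \<in> {1..m}" "l \<in> {1..m}" using mm(2) by blast+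
        then have "r k = r l" using rM[of k] rM[of l] kl(3) by linarith
        then show "k = l" using inj_onD[OF inj] kl by blast
      qed
      then have "W \<le> (\<Sum>k=1..b. ?w k * (M - r k))"
        unfolding W_def using k0 w1 mono
        by (intro rearrangement_lower_bound_except[where ?k0.0 = k0]) auto
      moreover have "U = V + c" using UVeq 2[symmetric] by (simp add: algebra_simps)
      ultimately show False using Ucomp cW by simp
    next
      case 3
      have "\<exists>k0\<in>{1..b}. ?w k0 = 1 \<and> (\<exists>y. \<forall>k\<in>{1..b} - {k0}. t k = y)"
        by (rule weighted_sum_excess_one[OF _ posB dw d0 tT tr(2)[OF mm(1)]])
          (use 3 in \<open>auto simp: P_def Q_def\<close>)
      then obtain k0 y where k0: "k0 \<in> {1..b}" "?w k0 = 1" "\<forall>k\<in>{1..b} - {k0}. t k = y" by blast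
      then have inj: "inj_on r ({1..b} - {k0})" using mb by (intro injr[OF _ k0(3)]) auto
      then have "W \<le> U"
        unfolding W_def U_def using k0 w1 mono
        by (intro rearrangement_lower_bound_except[where ?k0.0 = k0]) auto
      \<comment> \<open>Hence \<open>V \<ge> W + c = 1 + d * M\<close>, beyond the maximum of
        \<open>V\<close>.\<close>
      moreover have "V = U + c" using UVeq 3 by (simp add: algebra_simps)
      ultimately show False using V cW by simp
    qed
  qed

  \<comment> \<open>The full sum is \<open>d - 1\<close>, attained by \<open>{2..b}\<close>; smaller
    values are supplied by (ii), used here with \<open>r1 = 0\<close> only for its set
    \<open>H\<close>.\<close>
  have subset_sums: "\<exists>H\<subseteq>{2..b}. sum ?w H = j" if j: "j \<le> sum ?w {2..b}" for j
  proof (cases "j = sum ?w {2..b}")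
    case True
    then show ?thesis by blast
  next
    case False
    then have "j + 2 \<le> d" using j dw2 by simp
    then show ?thesis using ii[OF c0, of j] unfolding mb by auto
  qed

  have Asol: "has_distinct_solution E (insert n {s \<in> A. s < n})" if n: "n \<notin> A" for n
  proof -
    define u r1 where "u = n div c" and "r1 = n mod c"
    have nu: "n = c * u + r1" by (simp add: u_def r1_def)
    have r1: "r1 < c" using c0 by (simp add: r1_def)
    show ?thesis
    proof (cases "u \<in> ?T")
      case True
      have "r1 \<notin> R" using n nu True unfolding A_def by blast
      have small: "s \<in> R" if s: "s \<in> range (greedy_seq E)" "s < c" for s
      proof -
        obtain k where k: "s = a k" using s(1) a by blast
        then have "k \<in> {0..z}" using s(2) c strict_mono_less[OF amono, of k "z + 1"] by simp
        then show ?thesis using R k by blast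
      qed
      then have "r1 \<notin> range (greedy_seq E)" using \<open>r1 \<notin> R\<close> r1 by blast
      then have "has_distinct_solution E (insert r1 {s \<in> range (greedy_seq E). s < r1})"
        using in_range_greedy_seq_iff[OF valid] by blast
      then have "has_distinct_solution E
          ((+) (c * u) ` insert r1 {s \<in> range (greedy_seq E). s < r1})"
        by (rule has_distinct_solution_translate)
      moreover have "(+) (c * u) ` insert r1 {s \<in> range (greedy_seq E). s < r1}
          \<subseteq> insert n {s \<in> A. s < n}"
      proof
        fix y assume "y \<in> (+) (c * u) ` insert r1 {s \<in> range (greedy_seq E). s < r1}"
        then obtain s where s: "y = c * u + s" "s = r1 \<or> (s \<in> range (greedy_seq E) \<and> s < r1)"
          by blast
        show "y \<in> insert n {s \<in> A. s < n}"
        proof (cases "s = r1")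
          case False
          then have "s \<in> R" "s < r1" using s(2) small[of s] r1 by auto
          moreover from \<open>s \<in> R\<close> have "y \<in> A" using s(1) True unfolding A_def by blast
          ultimately show ?thesis using s(1) nu by simp
        qed (use s nu in simp)
      qed
      ultimately show ?thesis using has_distinct_solution_mono by blast
    next
      case False
      have "\<exists>j. j + 2 \<le> d \<and> (\<forall>H\<subseteq>{2..b}. sum ?w H = j \<longrightarrow>
        (\<exists>t. (\<forall>k\<in>insert m {2..b}. t k \<in> ?T \<and> t k < u) \<and>
          u + (\<Sum>k\<in>{2..b}. ?w k * t k) = d * t m \<and>
          (\<forall>k\<in>insert m H. \<forall>l\<in>{2..b} - H. t k \<noteq> t l)))"
        using mb by (intro separated_digitwise_solution dw2 subset_sums False) auto
      then obtain j where j: "j + 2 \<le> d" and jH: "\<And>H. H \<subseteq> {2..b} \<Longrightarrow> sum ?w H = j \<Longrightarrow>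
        \<exists>t. (\<forall>k\<in>insert m {2..b}. t k \<in> ?T \<and> t k < u) \<and>
          u + (\<Sum>k\<in>{2..b}. ?w k * t k) = d * t m \<and>
          (\<forall>k\<in>insert m H. \<forall>l\<in>{2..b} - H. t k \<noteq> t l)" by blast
      obtain H r where H: "H \<subseteq> {2..b}" "r 1 = r1" "\<forall>k\<in>{2..m}. r k \<in> R"
        "(\<Sum>k\<in>H. ?w k) = j" "(\<Sum>k=1..b. ?w k * r k) = d * r m"
        "inj_on r (H \<union> {m})" "inj_on r ({2..b} - H)"
        using ii[OF r1 j] unfolding mb by auto
      obtain t where t: "\<forall>k\<in>insert m {2..b}. t k \<in> ?T \<and> t k < u"
        "u + (\<Sum>k\<in>{2..b}. ?w k * t k) = d * t m"
        "\<forall>k\<in>insert m H. \<forall>l\<in>{2..b} - H. t k \<noteq> t l"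
        using jH[OF H(1,4)] by blast
      \<comment> \<open>Index 1, of weight 1, receives quotient \<open>u\<close> and remainder
        \<open>r1\<close>, so that \<open>x 1 = n\<close>.\<close>
      define t' where "t' = t(1 := u)"
      define x where "x k = r k + c * t' k" for k
      have m1: "m \<noteq> 1" "insert m {2..b} = {2..m}" using mb b1 by auto
      have t': "t' k = t k" if "k \<in> {2..m}" for k using that by (auto simp: t'_def)
      have x1: "x 1 = n" using nu H(2) by (simp add: x_def t'_def)
      have xk: "x k \<in> A \<and> x k < n" if "k \<in> {2..m}" for k
      proof -
        have tk: "t k \<in> ?T" "t k < u" "r k \<in> R" using t(1) H(3) that m1(2) by auto
        have "r k + c * t k < c * (t k + 1)" using Rc[OF tk(3)] by simp
        also have "\<dots> \<le> c * u" using tk(2) by (intro mult_le_mono) auto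
        finally have "r k + c * t k < n" using nu by simp
        moreover have "r k + c * t k \<in> A" unfolding A_def using tk by (auto simp: add.commute)
        ultimately show ?thesis using t'[OF that] by (simp add: x_def)
      qed
      have dig: "r k = r l \<and> t k = t l" if "x k = x l" "k \<in> {2..m}" "l \<in> {2..m}" for k l
      proof -
        have eq: "r k + c * t k = r l + c * t l" using that t' by (simp add: x_def)
        have lt: "r k < c" "r l < c" using that H(3) Rc by auto
        have "r k = r l"
          using arg_cong[OF eq, of "\<lambda>y. y mod c"] lt by simp
        then show ?thesis using eq c0 by simp
      qed
      \<comment> \<open>Equal \<open>x k\<close> have equal quotients, which places both indices in
        \<open>insert m H\<close> or both in \<open>{2..b} - H\<close>; on each class (ii) makes the
        remainders distinct.\<close>
      have "inj_on x {2..m}"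
      proof (rule inj_onI)
        fix k l assume kl: "k \<in> {2..m}" "l \<in> {2..m}" "x k = x l"
        then have rt: "r k = r l" "t k = t l" using dig[OF kl(3,1,2)] by blast+
        have "k \<in> insert m H \<or> k \<in> {2..b} - H" "l \<in> insert m H \<or> l \<in> {2..b} - H"
          using kl m1(2) by blast+
        then consider "k \<in> insert m H" "l \<in> insert m H" | "k \<in> {2..b} - H" "l \<in> {2..b} - H"
          using rt(2) t(3) by metis
        then show "k = l"
          by cases (use rt(1) inj_onD[OF H(6)] inj_onD[OF H(7)] in blast)+
      qed
      moreover have "x 1 \<notin> x ` {2..m}"
      proof
        assume "x 1 \<in> x ` {2..m}"
        then obtain k where "k \<in> {2..m}" "x k = n" using x1 by force
        then show False using xk[of k] by simp
      qed
      ultimately have "inj_on x (insert 1 {2..m})" by auto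
      moreover have ins: "insert 1 {2..m} = {1..m}" using mb by auto
      ultimately have "inj_on x {1..m}" by metis
      moreover have "x ` {1..m} \<subseteq> insert n {s \<in> A. s < n}"
        unfolding ins[symmetric] using x1 xk by blast
      moreover have "(\<Sum>k=1..b. ?w k * x k) = d * x m"
      proof -
        have "(\<Sum>k=1..b. ?w k * t' k) = u + (\<Sum>k=2..b. ?w k * t' k)"
          using b1 w1 by (simp add: sum.atLeast_Suc_atMost numeral_2_eq_2 t'_def)
        also have "(\<Sum>k=2..b. ?w k * t' k) = (\<Sum>k=2..b. ?w k * t k)"
          using t' mb by (intro sum.cong) auto
        finally have "(\<Sum>k=1..b. ?w k * t' k) = d * t' m"
          using t(2) m1(1) by (simp add: t'_def)
        moreover have "(\<Sum>k=1..b. ?w k * x k) =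
            (\<Sum>k=1..b. ?w k * r k) + c * (\<Sum>k=1..b. ?w k * t' k)"
          by (rule sum_weighted_digits) (rule x_def)
        ultimately show ?thesis using H(5) by (simp add: x_def algebra_simps)
      qed
      ultimately show ?thesis
        unfolding has_distinct_solution_def m d b_def by blast
    qed
  qed

  \<comment> \<open>Below \<open>n\<close> both sets agree by induction, so the same test decides
    membership of \<open>n\<close>: \<open>Ano\<close> settles \<open>n \<in> A\<close> and
    \<open>Asol\<close> the other case.\<close>
  have main: "n \<in> range a \<longleftrightarrow> n \<in> A" for n
  proof (induction n rule: less_induct)
    case (less n)
    then have "{s \<in> range a. s < n} = {s \<in> A. s < n}" by blast
    then have iff: "n \<in> range a \<longleftrightarrow> \<not> has_distinct_solution E (insert n {s \<in> A. s < n})"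
      using in_range_greedy_seq_iff[OF valid, of n] unfolding a by (simp only:)
    show ?case
    proof (cases "n \<in> A")
      case True
      then have "insert n {s \<in> A. s < n} \<subseteq> A" by blast
      then show ?thesis using iff True Ano has_distinct_solution_mono by blast
    next
      case False
      then show ?thesis using iff Asol by blast
    qed
  qed

  show ?thesis
  proof
    fix n
    have "a n \<in> A" using main by blast
    then obtain t r where t: "a n = c * t + r" "t \<in> ?T" "r \<in> R" unfolding A_def by blast
    obtain F where F: "finite F" "t = (\<Sum>i\<in>F. (d + 1) ^ i)"
      using binary_digit_numbers_sum_powers[OF t(2)] by blast
    let ?t = "\<lambda>i. of_bool (i \<in> F) :: nat"
    have "{i. ?t i \<noteq> 0} = F" by auto
    moreover have "(\<Sum>i\<in>F. ?t i * (d + 1) ^ i) = t" unfolding F(2) by (intro sum.cong) auto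
    ultimately show "\<exists>(t :: nat \<Rightarrow> nat) r. (\<forall>i. t i \<in> {0, 1}) \<and> finite {i. t i \<noteq> 0} \<and> r \<in> R \<and>
      a n = c * (\<Sum>i | t i \<noteq> 0. t i * (d + 1) ^ i) + r"
      using t F by (intro exI[of _ ?t] exI[of _ r]) auto
  qed
qed

end
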